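(* Let $\mathcal V$ be a $3$-distributive variety. Then in every algebra $\mathbf A\in\mathcal V$ the following inclusions hold for all reflexive admissible relations $R,S,T$ on $\mathbf A$ and every congruence $\gamma$ of $\mathbf A$: (1) $R(S\circ T)\subseteq RS\circ RT\circ RT\circ RS$; (2) $R(S\circ T)\subseteq RS\circ RT\circ RS\circ RT$; (3) $R(S\circ\gamma)\subseteq RS\circ R\gamma\circ RS$.
   Context: A binary relation on an algebra $\mathbf A$ is admissible if it is compatible with all operations, i.e. it is a subalgebra of $\mathbf A\times\mathbf A$. Juxtaposition of relations denotes intersection and binds more tightly than relational composition $\circ$, where $a\,(S\circ T)\,c$ iff there is $b$ with $a\,S\,b\,T\,c$. A variety is $3$-distributive if $\alpha(\beta\circ\gamma)\subseteq\alpha\beta\circ\alpha\gamma\circ\alpha\beta$ for all congruences $\alpha,\beta,\gamma$ of every algebra in the variety; equivalently (Jónsson), if it has ternary terms $j_1,j_2$ satisfying the equations $x=j_1(x,x,z)$, $j_1(x,z,z)=j_2(x,z,z)$, $j_2(x,x,z)=z$, $x=j_1(x,y,x)$, $j_2(z,y,z)=z$. *)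

theory Defs
  imports Main
begin

record 'f signature =
  symbols :: "'f set"
  arity :: "'f \<Rightarrow> nat"

datatype ('f, 'v) trm = Var 'v | App 'f "('f, 'v) trm list"

fun wf_trm :: "'f signature \<Rightarrow> ('f, 'v) trm \<Rightarrow> bool" where
  "wf_trm sg (Var x) \<longleftrightarrow> True"
| "wf_trm sg (App f ts) \<longleftrightarrow>
     f \<in> symbols sg \<and> length ts = arity sg f \<and> (\<forall>t\<in>set ts. wf_trm sg t)"

record ('f, 'a) alg =
  univ :: "'a set"
  oper :: "'f \<Rightarrow> 'a list \<Rightarrow> 'a"

definition is_algebra :: "'f signature \<Rightarrow> ('f, 'a) alg \<Rightarrow> bool" where
  "is_algebra sg A \<longleftrightarrow> univ A \<noteq> {} \<and>
     (\<forall>f\<in>symbols sg. \<forall>xs\<in>lists (univ A). length xs = arity sg f \<longrightarrow> oper A f xs \<in> univ A)"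

fun eval_trm :: "('f, 'a) alg \<Rightarrow> ('v \<Rightarrow> 'a) \<Rightarrow> ('f, 'v) trm \<Rightarrow> 'a" where
  "eval_trm A v (Var x) = v x"
| "eval_trm A v (App f ts) = oper A f (map (eval_trm A v) ts)"

text \<open>A variety is presented as an equational class: the class of all algebras of signature
  \<open>sg\<close> satisfying a set \<open>E\<close> of equations between terms in countably many variables.\<close>

type_synonym 'f equation = "('f, nat) trm \<times> ('f, nat) trm"

definition wf_equations :: "'f signature \<Rightarrow> 'f equation set \<Rightarrow> bool" where
  "wf_equations sg E \<longleftrightarrow> (\<forall>(s, t)\<in>E. wf_trm sg s \<and> wf_trm sg t)"

definition satisfies :: "('f, 'a) alg \<Rightarrow> 'f equation \<Rightarrow> bool" where
  "satisfies A e \<longleftrightarrow>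
     (\<forall>v. range v \<subseteq> univ A \<longrightarrow> eval_trm A v (fst e) = eval_trm A v (snd e))"

definition in_variety :: "'f signature \<Rightarrow> 'f equation set \<Rightarrow> ('f, 'a) alg \<Rightarrow> bool" where
  "in_variety sg E A \<longleftrightarrow> is_algebra sg A \<and> (\<forall>e\<in>E. satisfies A e)"

definition admissible :: "'f signature \<Rightarrow> ('f, 'a) alg \<Rightarrow> 'a rel \<Rightarrow> bool" where
  "admissible sg A R \<longleftrightarrow> R \<subseteq> univ A \<times> univ A \<and>
     (\<forall>f\<in>symbols sg. \<forall>xs ys. length xs = arity sg f \<and> list_all2 (\<lambda>x y. (x, y) \<in> R) xs ys
        \<longrightarrow> (oper A f xs, oper A f ys) \<in> R)"

definition congruence :: "'f signature \<Rightarrow> ('f, 'a) alg \<Rightarrow> 'a rel \<Rightarrow> bool" where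
  "congruence sg A R \<longleftrightarrow> equiv (univ A) R \<and> admissible sg A R"

text \<open>A definition in HOL cannot quantify over all carrier types, so \<open>three_distributive\<close> ranges
  over the members of the variety whose universe is a subset of the type \<open>('f, nat) trm set\<close>. This
  type contains the universe of the free algebra of the variety on countably many generators
  (congruence classes of terms), which is where Jonsson's terms are found; hence the condition
  gives the congruence inclusion in the members of the variety over every carrier type.\<close>

definition three_distributive :: "'f signature \<Rightarrow> 'f equation set \<Rightarrow> bool" where
  "three_distributive sg E \<longleftrightarrow>
     (\<forall>A :: ('f, ('f, nat) trm set) alg. in_variety sg E A \<longrightarrow>
        (\<forall>\<alpha> \<beta> \<gamma>. congruence sg A \<alpha> \<and> congruence sg A \<beta> \<and> congruence sg A \<gamma> \<longrightarrow>
           \<alpha> \<inter> (\<beta> O \<gamma>) \<subseteq> (\<alpha> \<inter> \<beta>) O (\<alpha> \<inter> \<gamma>) O (\<alpha> \<inter> \<beta>)))"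

end

theory Submission
  imports Defs
begin

text \<open>
  The hypothesis on congruences is first turned into term operations. In the free algebra of the
  variety on countably many generators, let \<open>x\<close>, \<open>y\<close>, \<open>z\<close> be three of the generators and let
  \<open>\<alpha>\<close>, \<open>\<beta>\<close>, \<open>\<gamma>\<close> be the kernels of the endomorphisms that identify \<open>z\<close> with \<open>x\<close>, \<open>y\<close> with \<open>x\<close>
  and \<open>y\<close> with \<open>z\<close>. Then \<open>(x, z)\<close> lies in \<open>\<alpha> \<inter> (\<beta> O \<gamma>)\<close>, and the two intermediate elements of the
  path given by 3-distributivity are classes of terms \<open>f\<close>, \<open>g\<close>. Membership in a kernel is an
  equation between terms, so the path says exactly that \<open>f\<close>, \<open>g\<close> satisfy Jonsson's equations
  \<open>f x y x = x\<close>, \<open>f x x z = x\<close>, \<open>f x z z = g x z z\<close>, \<open>g x x z = z\<close>, \<open>g z y z = z\<close>. Derivable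
  equations hold in all members of the variety, on every carrier type
  (\<open>jonsson_operations_exist\<close>).

  Now suppose \<open>a R c\<close> and \<open>a S b T c\<close>. For congruences the path from \<open>a\<close> to \<open>c\<close> through
  \<open>f a b c\<close>, \<open>f a c c = g a c c\<close> and \<open>g a b c\<close> works. Without symmetry and transitivity
  the later steps of this path may run in the wrong direction, and the intermediate elements need not be
  \<open>R\<close>-related to each other. The remedy is to use composite terms. Two mechanisms produce the
  missing pairs. The first is absorption: if \<open>u R w\<close> then \<open>u = f u v u R f u v w R f w v w = w\<close>,
  and likewise for \<open>g\<close>. The second is to rewrite an element \<open>u\<close> as \<open>g v v u\<close> or as \<open>f u u v\<close> with
  suitable \<open>v\<close> before applying compatibility. Different relations may use different
  representations of the same element. The intermediate elements are, with \<open>y = f c b a\<close>,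
  \<^item> for (1): \<open>f a b y\<close>, \<open>f a y y = g a y y\<close>, \<open>g (g c b a) y c\<close>;
  \<^item> for (2): \<open>f a b c\<close>, \<open>f a c c = g a c c\<close>, \<open>g (f a b c) (g a b c) c\<close>;
  \<^item> for (3): \<open>f a b c\<close>, \<open>f (g a b c) (g a c b) c\<close>.
\<close>

section \<open>Relation inclusions from Jonsson operations\<close>

locale jonsson_operations =
  fixes U :: "'a set" and f g :: "'a \<Rightarrow> 'a \<Rightarrow> 'a \<Rightarrow> 'a"
  assumes f_closed: "\<lbrakk>x \<in> U; y \<in> U; z \<in> U\<rbrakk> \<Longrightarrow> f x y z \<in> U"
    and g_closed: "\<lbrakk>x \<in> U; y \<in> U; z \<in> U\<rbrakk> \<Longrightarrow> g x y z \<in> U"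
    and f_xyx: "\<lbrakk>x \<in> U; y \<in> U\<rbrakk> \<Longrightarrow> f x y x = x"
    and f_xxz: "\<lbrakk>x \<in> U; z \<in> U\<rbrakk> \<Longrightarrow> f x x z = x"
    and f_xzz: "\<lbrakk>x \<in> U; z \<in> U\<rbrakk> \<Longrightarrow> f x z z = g x z z"
    and g_xxz: "\<lbrakk>x \<in> U; z \<in> U\<rbrakk> \<Longrightarrow> g x x z = z"
    and g_zyz: "\<lbrakk>z \<in> U; y \<in> U\<rbrakk> \<Longrightarrow> g z y z = z"
begin

definition refl_compatible :: "'a rel \<Rightarrow> bool" where
  "refl_compatible R \<longleftrightarrow> refl_on U R \<and> R \<subseteq> U \<times> U \<and>
     (\<forall>x y z x' y' z'. (x, x') \<in> R \<longrightarrow> (y, y') \<in> R \<longrightarrow> (z, z') \<in> R \<longrightarrow>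
        (f x y z, f x' y' z') \<in> R \<and> (g x y z, g x' y' z') \<in> R)"

lemma refl_compatibleD:
  assumes "refl_compatible R"
  shows refl_compatible_refl: "x \<in> U \<Longrightarrow> (x, x) \<in> R"
    and refl_compatible_f:
      "\<lbrakk>(x, x') \<in> R; (y, y') \<in> R; (z, z') \<in> R\<rbrakk> \<Longrightarrow> (f x y z, f x' y' z') \<in> R"
    and refl_compatible_g:
      "\<lbrakk>(x, x') \<in> R; (y, y') \<in> R; (z, z') \<in> R\<rbrakk> \<Longrightarrow> (g x y z, g x' y' z') \<in> R"
    and refl_compatible_field: "(x, y) \<in> R \<Longrightarrow> x \<in> U \<and> y \<in> U"
  using assms unfolding refl_compatible_def refl_on_def by blast+

lemma absorption:
  assumes R: "refl_compatible R" and uw: "(u, w) \<in> R" and v: "v \<in> U"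
  shows f_absorb_left: "(u, f u v w) \<in> R" and f_absorb_right: "(f u v w, w) \<in> R"
    and g_absorb_left: "(u, g u v w) \<in> R" and g_absorb_right: "(g u v w, w) \<in> R"
    and f_absorb_left_rev: "(u, f w v u) \<in> R" and f_absorb_right_rev: "(f w v u, w) \<in> R"
    and g_absorb_left_rev: "(u, g w v u) \<in> R" and g_absorb_right_rev: "(g w v u, w) \<in> R"
proof -
  have uU: "u \<in> U" and wU: "w \<in> U"
    using refl_compatible_field[OF R uw] by auto
  note rfl = refl_compatible_refl[OF R]
  note eqs = f_xyx[OF uU v] f_xyx[OF wU v] g_zyz[OF uU v] g_zyz[OF wU v]
  note ff = refl_compatible_f[OF R _ rfl[OF v]] and gg = refl_compatible_g[OF R _ rfl[OF v]]
  show "(u, f u v w) \<in> R" using ff[OF rfl[OF uU] uw] eqs by simp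
  show "(f u v w, w) \<in> R" using ff[OF uw rfl[OF wU]] eqs by simp
  show "(u, g u v w) \<in> R" using gg[OF rfl[OF uU] uw] eqs by simp
  show "(g u v w, w) \<in> R" using gg[OF uw rfl[OF wU]] eqs by simp
  show "(u, f w v u) \<in> R" using ff[OF uw rfl[OF uU]] eqs by simp
  show "(f w v u, w) \<in> R" using ff[OF rfl[OF wU] uw] eqs by simp
  show "(u, g w v u) \<in> R" using gg[OF uw rfl[OF uU]] eqs by simp
  show "(g w v u, w) \<in> R" using gg[OF rfl[OF wU] uw] eqs by simp
qed

text \<open>The middle element \<open>f a y y\<close> is reached by \<open>T\<close> as a value of \<open>f\<close> and left as a value of \<open>g\<close>.
  The element \<open>y = f c b a\<close> lies above \<open>b\<close> and below \<open>c\<close> with respect to \<open>T\<close>, and between \<open>a\<close> and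
  \<open>c\<close> with respect to \<open>R\<close>. The last step uses that \<open>g c b a\<close> and \<open>y\<close> have the common \<open>S\<close>-successor
  \<open>f c b b = g c b b\<close>, so that the first two arguments of \<open>g\<close> can be merged.\<close>

lemma inclusion_RS_RT_RT_RS:
  assumes R: "refl_compatible R" and S: "refl_compatible S" and T: "refl_compatible T"
  shows "R \<inter> (S O T) \<subseteq> (R \<inter> S) O (R \<inter> T) O (R \<inter> T) O (R \<inter> S)"
proof clarify
  fix a c b assume ac: "(a, c) \<in> R" and ab: "(a, b) \<in> S" and bc: "(b, c) \<in> T"
  have aU: "a \<in> U" and bU: "b \<in> U" and cU: "c \<in> U"
    using refl_compatible_field[OF S ab] refl_compatible_field[OF T bc] by auto
  note rR = refl_compatible_refl[OF R] and rS = refl_compatible_refl[OF S]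
    and rT = refl_compatible_refl[OF T]
  define y where "y = f c b a"
  define p where "p = f a b y"
  define q where "q = f a y y"
  define r where "r = g (g c b a) y c"
  have yU: "y \<in> U" unfolding y_def by (intro f_closed aU bU cU)
  have pU: "p \<in> U" unfolding p_def by (intro f_closed aU bU yU)
  have q_eq: "q = g a y y" unfolding q_def by (rule f_xzz[OF aU yU])
  have ay: "(a, y) \<in> R" and yc: "(y, c) \<in> R"
    unfolding y_def by (rule absorption[OF R ac bU])+
  have by_T: "(b, y) \<in> T"
    using refl_compatible_f[OF T bc rT[OF bU] rT[OF aU]] f_xxz[OF bU aU] by (simp add: y_def)
  have yc_T: "(y, c) \<in> T"
    using refl_compatible_f[OF T rT[OF cU] bc rT[OF aU]] f_xxz[OF cU aU] by (simp add: y_def)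
  have ap: "(a, p) \<in> R \<inter> S"
  proof
    show "(a, p) \<in> R" unfolding p_def by (rule f_absorb_left[OF R ay bU])
    show "(a, p) \<in> S"
      using refl_compatible_f[OF S rS[OF aU] ab rS[OF yU]] f_xxz[OF aU yU] by (simp add: p_def)
  qed
  have pq: "(p, q) \<in> R \<inter> T"
  proof
    have "(p, y) \<in> R" unfolding p_def by (rule f_absorb_right[OF R ay bU])
    \<comment> \<open>Nothing relates \<open>b\<close> to \<open>y\<close> by \<open>R\<close>; reading \<open>p\<close> as \<open>g a a p\<close> removes \<open>b\<close> from the comparison.\<close>
    then show "(p, q) \<in> R"
      using refl_compatible_g[OF R rR[OF aU] ay] g_xxz[OF aU pU] by (metis q_eq)
    show "(p, q) \<in> T"
      unfolding p_def q_def by (rule refl_compatible_f[OF T rT[OF aU] by_T rT[OF yU]])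
  qed
  have qr: "(q, r) \<in> R \<inter> T"
  proof
    show "(q, r) \<in> R"
      unfolding q_eq r_def
      by (rule refl_compatible_g[OF R g_absorb_left_rev[OF R ac bU] rR[OF yU] yc])
    have "(a, g c b a) \<in> T"
      using refl_compatible_g[OF T bc rT[OF bU] rT[OF aU]] g_xxz[OF bU aU] by simp
    then show "(q, r) \<in> T"
      unfolding q_eq r_def by (rule refl_compatible_g[OF T _ rT[OF yU] yc_T])
  qed
  have rc: "(r, c) \<in> R \<inter> S"
  proof
    show "(r, c) \<in> R"
      using refl_compatible_g[OF R g_absorb_right_rev[OF R ac bU] rR[OF yU] rR[OF cU]]
        g_zyz[OF cU yU] by (simp add: r_def)
    let ?w = "g c b b"
    have wU: "?w \<in> U" by (intro g_closed bU cU)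
    have "(g c b a, ?w) \<in> S" by (rule refl_compatible_g[OF S rS[OF cU] rS[OF bU] ab])
    moreover have "(y, ?w) \<in> S"
      using refl_compatible_f[OF S rS[OF cU] rS[OF bU] ab] f_xzz[OF cU bU] by (simp add: y_def)
    ultimately show "(r, c) \<in> S"
      using refl_compatible_g[OF S _ _ rS[OF cU]] g_xxz[OF wU cU] by (metis r_def)
  qed
  from ap pq qr rc show "(a, c) \<in> (R \<inter> S) O (R \<inter> T) O (R \<inter> T) O (R \<inter> S)" by blast
qed

text \<open>The third step starts from \<open>q = g a c c\<close>, read in two ways: the relation \<open>R\<close> sees \<open>q\<close> as
  \<open>g a a q\<close>, whereas \<open>S\<close> sees it as \<open>g a (g a a c) c\<close>. In the last step \<open>T\<close> turns every \<open>b\<close> into \<open>c\<close>,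
  after which the first two arguments of \<open>g\<close> agree.\<close>

lemma inclusion_RS_RT_RS_RT:
  assumes R: "refl_compatible R" and S: "refl_compatible S" and T: "refl_compatible T"
  shows "R \<inter> (S O T) \<subseteq> (R \<inter> S) O (R \<inter> T) O (R \<inter> S) O (R \<inter> T)"
proof clarify
  fix a c b assume ac: "(a, c) \<in> R" and ab: "(a, b) \<in> S" and bc: "(b, c) \<in> T"
  have aU: "a \<in> U" and bU: "b \<in> U" and cU: "c \<in> U"
    using refl_compatible_field[OF S ab] refl_compatible_field[OF T bc] by auto
  note rR = refl_compatible_refl[OF R] and rS = refl_compatible_refl[OF S]
    and rT = refl_compatible_refl[OF T]
  define p where "p = f a b c"
  define h where "h = g a b c"
  define q where "q = f a c c"
  define r where "r = g p h c"
  have pU: "p \<in> U" unfolding p_def by (intro f_closed aU bU cU)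
  have hU: "h \<in> U" unfolding h_def by (intro g_closed aU bU cU)
  have qU: "q \<in> U" unfolding q_def by (intro f_closed aU cU)
  have q_eq: "q = g a c c" unfolding q_def by (rule f_xzz[OF aU cU])
  have ap_R: "(a, p) \<in> R" and pc_R: "(p, c) \<in> R"
    unfolding p_def by (rule absorption[OF R ac bU])+
  have ap_S: "(a, p) \<in> S"
    using refl_compatible_f[OF S rS[OF aU] ab rS[OF cU]] f_xxz[OF aU cU] by (simp add: p_def)
  have pq_T: "(p, q) \<in> T"
    unfolding p_def q_def by (rule refl_compatible_f[OF T rT[OF aU] bc rT[OF cU]])
  have pq: "(p, q) \<in> R \<inter> T"
  proof
    show "(p, q) \<in> R"
      using refl_compatible_g[OF R rR[OF aU] ac pc_R] g_xxz[OF aU pU] by (simp add: q_eq)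
  qed (rule pq_T)
  have qr: "(q, r) \<in> R \<inter> S"
  proof
    have ah: "(a, h) \<in> R" unfolding h_def by (rule g_absorb_left[OF R ac bU])
    have qc: "(q, c) \<in> R" unfolding q_def by (rule f_absorb_right[OF R ac cU])
    show "(q, r) \<in> R"
      using refl_compatible_g[OF R ap_R ah qc] g_xxz[OF aU qU] by (simp add: r_def)
    have "(c, h) \<in> S"
      using refl_compatible_g[OF S rS[OF aU] ab rS[OF cU]] g_xxz[OF aU cU] by (simp add: h_def)
    then show "(q, r) \<in> S"
      unfolding q_eq r_def by (rule refl_compatible_g[OF S ap_S _ rS[OF cU]])
  qed
  have rc: "(r, c) \<in> R \<inter> T"
  proof
    show "(r, c) \<in> R" unfolding r_def by (rule g_absorb_right[OF R pc_R hU])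
    have "(h, q) \<in> T"
      unfolding h_def q_eq by (rule refl_compatible_g[OF T rT[OF aU] bc rT[OF cU]])
    then show "(r, c) \<in> T"
      using refl_compatible_g[OF T pq_T _ rT[OF cU]] g_xxz[OF qU cU] by (metis r_def)
  qed
  from ap_R ap_S pq qr rc show "(a, c) \<in> (R \<inter> S) O (R \<inter> T) O (R \<inter> S) O (R \<inter> T)" by blast
qed

text \<open>Modulo \<open>\<gamma>\<close> the element \<open>c\<close> may be replaced by \<open>b\<close>. Then \<open>g a b c\<close> and \<open>g a c b\<close> both become
  \<open>g a b b = f a b b\<close>, so the second intermediate element collapses to the first one. The entry
  \<open>g a c b\<close> stands in place of \<open>b\<close> because it is an \<open>R\<close>-successor of \<open>b = g a a b\<close>.\<close>

lemma inclusion_RS_Rcong_RS: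
  assumes R: "refl_compatible R" and S: "refl_compatible S"
    and \<gamma>: "refl_compatible \<gamma>" "sym \<gamma>" "trans \<gamma>"
  shows "R \<inter> (S O \<gamma>) \<subseteq> (R \<inter> S) O (R \<inter> \<gamma>) O (R \<inter> S)"
proof clarify
  fix a c b assume ac: "(a, c) \<in> R" and ab: "(a, b) \<in> S" and bc: "(b, c) \<in> \<gamma>"
  have aU: "a \<in> U" and bU: "b \<in> U" and cU: "c \<in> U"
    using refl_compatible_field[OF S ab] refl_compatible_field[OF \<gamma>(1) bc] by auto
  note rR = refl_compatible_refl[OF R] and rS = refl_compatible_refl[OF S]
    and r\<gamma> = refl_compatible_refl[OF \<gamma>(1)]
  define p where "p = f a b c"
  define h where "h = g a b c"
  define k where "k = g a c b"
  define q where "q = f h k c"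
  have kU: "k \<in> U" unfolding k_def by (intro g_closed aU bU cU)
  have ap: "(a, p) \<in> R \<inter> S"
  proof
    show "(a, p) \<in> R" unfolding p_def by (rule f_absorb_left[OF R ac bU])
    show "(a, p) \<in> S"
      using refl_compatible_f[OF S rS[OF aU] ab rS[OF cU]] f_xxz[OF aU cU] by (simp add: p_def)
  qed
  have pq: "(p, q) \<in> R \<inter> \<gamma>"
  proof
    have "(a, h) \<in> R" unfolding h_def by (rule g_absorb_left[OF R ac bU])
    moreover have "(b, k) \<in> R"
      using refl_compatible_g[OF R rR[OF aU] ac rR[OF bU]] g_xxz[OF aU bU] by (simp add: k_def)
    ultimately show "(p, q) \<in> R"
      unfolding p_def q_def by (rule refl_compatible_f[OF R _ _ rR[OF cU]])
    define e where "e = g a b b"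
    have eU: "e \<in> U" unfolding e_def by (intro g_closed aU bU)
    have "(c, b) \<in> \<gamma>" using bc \<gamma>(2) by (rule symD[rotated])
    note to_b = refl_compatible_f[OF \<gamma>(1)] refl_compatible_g[OF \<gamma>(1)] r\<gamma>[OF aU] r\<gamma>[OF bU] this
    have "(f a b c, f a b b) \<in> \<gamma>" "(h, e) \<in> \<gamma>" "(k, e) \<in> \<gamma>"
      unfolding h_def k_def e_def by (intro to_b)+
    then have "(p, e) \<in> \<gamma>" and "(f h k c, f e e b) \<in> \<gamma>"
      using f_xzz[OF aU bU] to_b(1,5) by (auto simp: p_def e_def)
    then show "(p, q) \<in> \<gamma>"
      using f_xxz[OF eU bU] \<gamma>(2,3) by (metis q_def symD transD)
  qed
  have qc: "(q, c) \<in> R \<inter> S"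
  proof
    have "(h, c) \<in> R" unfolding h_def by (rule g_absorb_right[OF R ac bU])
    then show "(q, c) \<in> R" unfolding q_def by (rule f_absorb_right[OF R _ kU])
    have "(h, c) \<in> S"
      using refl_compatible_g[OF S ab rS[OF bU] rS[OF cU]] g_xxz[OF bU cU] by (simp add: h_def)
    then show "(q, c) \<in> S" unfolding q_def by (rule f_absorb_right[OF S _ kU])
  qed
  from ap pq qc show "(a, c) \<in> (R \<inter> S) O (R \<inter> \<gamma>) O (R \<inter> S)" by blast
qed

end

section \<open>Evaluation and substitution of terms\<close>

fun subst :: "('v \<Rightarrow> ('f, 'w) trm) \<Rightarrow> ('f, 'v) trm \<Rightarrow> ('f, 'w) trm" where
  "subst \<sigma> (Var x) = \<sigma> x"
| "subst \<sigma> (App f ts) = App f (map (subst \<sigma>) ts)"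

lemma wf_subst: "wf_trm sg t \<Longrightarrow> (\<And>x. wf_trm sg (\<sigma> x)) \<Longrightarrow> wf_trm sg (subst \<sigma> t)"
  by (induction t) auto

lemma subst_subst: "subst \<tau> (subst \<sigma> t) = subst (subst \<tau> \<circ> \<sigma>) t"
  by (induction t) auto

lemma eval_subst: "eval_trm A v (subst \<sigma> t) = eval_trm A (eval_trm A v \<circ> \<sigma>) t"
proof (induction t)
  case (App f ts)
  then have "map (eval_trm A v) (map (subst \<sigma>) ts) = map (eval_trm A (eval_trm A v \<circ> \<sigma>)) ts"
    by (simp add: o_def)
  then show ?case by (simp only: subst.simps eval_trm.simps)
qed simp

lemma eval_closed:
  assumes "is_algebra sg A" and "range v \<subseteq> univ A"
  shows "wf_trm sg t \<Longrightarrow> eval_trm A v t \<in> univ A"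
proof (induction t)
  case (App f ts)
  then have "map (eval_trm A v) ts \<in> lists (univ A)" by auto
  with assms(1) App.prems show ?case unfolding is_algebra_def by simp
qed (use assms in auto)

lemma eval_admissible:
  assumes "admissible sg A R" and "\<And>x. (v x, w x) \<in> R"
  shows "wf_trm sg t \<Longrightarrow> (eval_trm A v t, eval_trm A w t) \<in> R"
proof (induction t)
  case (App f ts)
  then have "list_all2 (\<lambda>x y. (x, y) \<in> R) (map (eval_trm A v) ts) (map (eval_trm A w) ts)"
    by (auto simp: list_all2_conv_all_nth)
  with assms(1) App.prems show ?case unfolding admissible_def by simp
qed (use assms in auto)

section \<open>Derivable equations and the free algebra\<close>

text \<open>Equality in the free algebra is defined by derivability. Defining it as validity in the members
  of the variety would fix a carrier type, whereas a derivation can be evaluated on any carrier.\<close>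

inductive derivable :: "'f signature \<Rightarrow> 'f equation set \<Rightarrow> ('f, nat) trm \<Rightarrow> ('f, nat) trm \<Rightarrow> bool"
  for sg E where
  derivable_refl: "wf_trm sg t \<Longrightarrow> derivable sg E t t"
| derivable_sym: "derivable sg E s t \<Longrightarrow> derivable sg E t s"
| derivable_trans: "derivable sg E s t \<Longrightarrow> derivable sg E t u \<Longrightarrow> derivable sg E s u"
| derivable_inst: "(l, r) \<in> E \<Longrightarrow> (\<And>x. wf_trm sg (\<sigma> x)) \<Longrightarrow>
    derivable sg E (subst \<sigma> l) (subst \<sigma> r)"
| derivable_cong: "f \<in> symbols sg \<Longrightarrow> length ts = arity sg f \<Longrightarrow>
    list_all2 (derivable sg E) ts us \<Longrightarrow> derivable sg E (App f ts) (App f us)"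

lemma derivable_wf:
  assumes "wf_equations sg E"
  shows "derivable sg E s t \<Longrightarrow> wf_trm sg s \<and> wf_trm sg t"
proof (induction rule: derivable.induct)
  case (derivable_inst l r \<sigma>)
  then show ?case using assms wf_subst unfolding wf_equations_def by blast
next
  case (derivable_cong f ts us)
  then show ?case by (auto simp: list_all2_conv_all_nth in_set_conv_nth)
qed auto

lemma derivable_sound:
  assumes A: "in_variety sg E A" and v: "range v \<subseteq> univ A"
  shows "derivable sg E s t \<Longrightarrow> eval_trm A v s = eval_trm A v t"
proof (induction rule: derivable.induct)
  case (derivable_inst l r \<sigma>)
  have "range (eval_trm A v \<circ> \<sigma>) \<subseteq> univ A"
    using A v derivable_inst eval_closed unfolding in_variety_def by fastforce
  with A derivable_inst(1) show ?case
    unfolding in_variety_def satisfies_def eval_subst by fastforce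
next
  case (derivable_cong f ts us)
  then have "map (eval_trm A v) ts = map (eval_trm A v) us"
    by (auto simp: list_all2_conv_all_nth intro!: nth_equalityI)
  then show ?case by (simp only: eval_trm.simps)
qed auto

lemma derivable_subst:
  assumes "\<And>x. wf_trm sg (\<tau> x)"
  shows "derivable sg E s t \<Longrightarrow> derivable sg E (subst \<tau> s) (subst \<tau> t)"
proof (induction rule: derivable.induct)
  case (derivable_inst l r \<sigma>)
  then show ?case
    unfolding subst_subst by (intro derivable.derivable_inst) (simp_all add: assms wf_subst)
next
  case (derivable_cong f ts us)
  then show ?case
    unfolding subst.simps by (intro derivable.derivable_cong) (auto simp: list_all2_conv_all_nth)
qed (auto intro: derivable.intros wf_subst assms)

definition eq_class :: "'f signature \<Rightarrow> 'f equation set \<Rightarrow> ('f, nat) trm \<Rightarrow> ('f, nat) trm set" where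
  "eq_class sg E t = {s. derivable sg E s t}"

definition rep :: "('f, nat) trm set \<Rightarrow> ('f, nat) trm" where
  "rep X = (SOME t. t \<in> X)"

definition free_alg :: "'f signature \<Rightarrow> 'f equation set \<Rightarrow> ('f, ('f, nat) trm set) alg" where
  "free_alg sg E = \<lparr>univ = eq_class sg E ` Collect (wf_trm sg),
     oper = (\<lambda>f Xs. eq_class sg E (App f (map rep Xs)))\<rparr>"

lemma eq_class_eqI: "derivable sg E s t \<Longrightarrow> eq_class sg E s = eq_class sg E t"
  unfolding eq_class_def by (blast intro: derivable_sym derivable_trans)

lemma rep_eq_class: "wf_trm sg t \<Longrightarrow> derivable sg E (rep (eq_class sg E t)) t"
  unfolding rep_def eq_class_def by (rule someI2[of _ t]) (auto intro: derivable_refl)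

lemma eq_class_in_free: "wf_trm sg t \<Longrightarrow> eq_class sg E t \<in> univ (free_alg sg E)"
  by (simp add: free_alg_def)

context
  fixes sg :: "'f signature" and E :: "'f equation set"
  assumes wfE: "wf_equations sg E"
begin

lemma wf_rep: "X \<in> univ (free_alg sg E) \<Longrightarrow> wf_trm sg (rep X)"
  using derivable_wf[OF wfE rep_eq_class] by (auto simp: free_alg_def)

lemma eq_class_rep: "X \<in> univ (free_alg sg E) \<Longrightarrow> eq_class sg E (rep X) = X"
  using eq_class_eqI[OF rep_eq_class] by (auto simp: free_alg_def)

lemma wf_App_rep:
  assumes "f \<in> symbols sg" "length Xs = arity sg f" "set Xs \<subseteq> univ (free_alg sg E)"
  shows "wf_trm sg (App f (map rep Xs))"
  using assms wf_rep by auto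

lemma free_is_algebra: "is_algebra sg (free_alg sg E)"
proof -
  have "oper (free_alg sg E) f Xs \<in> univ (free_alg sg E)"
    if "f \<in> symbols sg" "Xs \<in> lists (univ (free_alg sg E))" "length Xs = arity sg f" for f Xs
    using eq_class_in_free[OF wf_App_rep[of f Xs]] that by (auto simp: free_alg_def)
  moreover have "wf_trm sg (Var 0 :: ('f, nat) trm)" by simp
  ultimately show ?thesis unfolding is_algebra_def using eq_class_in_free by blast
qed

lemma eval_free:
  assumes v: "range v \<subseteq> univ (free_alg sg E)"
  shows "wf_trm sg t \<Longrightarrow> eval_trm (free_alg sg E) v t = eq_class sg E (subst (rep \<circ> v) t)"
proof (induction t)
  case (Var x)
  then show ?case using v eq_class_rep by auto
next
  case (App f ts)
  have wf: "wf_trm sg (subst (rep \<circ> v) t)" if "t \<in> set ts" for t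
  proof (rule wf_subst)
    show "wf_trm sg t" using that App.prems by simp
    show "wf_trm sg ((rep \<circ> v) x)" for x using v wf_rep[of "v x"] by auto
  qed
  let ?us = "map (eval_trm (free_alg sg E) v) ts"
  have "map rep ?us = map (\<lambda>t. rep (eq_class sg E (subst (rep \<circ> v) t))) ts"
    using App by (simp add: o_def)
  then have "list_all2 (derivable sg E) (map rep ?us) (map (subst (rep \<circ> v)) ts)"
    using rep_eq_class[OF wf] by (auto simp: list_all2_conv_all_nth simp del: o_apply)
  then have "derivable sg E (App f (map rep ?us)) (App f (map (subst (rep \<circ> v)) ts))"
    using App.prems by (intro derivable_cong) auto
  then have "eq_class sg E (App f (map rep ?us)) = eq_class sg E (subst (rep \<circ> v) (App f ts))"
    unfolding subst.simps by (rule eq_class_eqI)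
  moreover have "eval_trm (free_alg sg E) v (App f ts) = eq_class sg E (App f (map rep ?us))"
    by (simp add: free_alg_def)
  ultimately show ?case by (rule trans[rotated])
qed

lemma free_in_variety: "in_variety sg E (free_alg sg E)"
proof -
  have "satisfies (free_alg sg E) (l, r)" if lr: "(l, r) \<in> E" for l r
    unfolding satisfies_def
  proof (intro allI impI)
    fix v :: "nat \<Rightarrow> ('f, nat) trm set" assume v: "range v \<subseteq> univ (free_alg sg E)"
    have "wf_trm sg l" "wf_trm sg r" using wfE lr unfolding wf_equations_def by auto
    moreover have "derivable sg E (subst (rep \<circ> v) l) (subst (rep \<circ> v) r)"
      using lr v wf_rep by (intro derivable_inst) auto
    ultimately show "eval_trm (free_alg sg E) v (fst (l, r)) = eval_trm (free_alg sg E) v (snd (l, r))"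
      using eval_free[OF v] eq_class_eqI by simp
  qed
  then show ?thesis using free_is_algebra unfolding in_variety_def by auto
qed

text \<open>The kernel of the endomorphism of the free algebra induced by \<open>\<sigma>\<close>. Defined through
  representatives it is visibly an equivalence relation; it does not depend on their choice
  because derivability is closed under substitution.\<close>

definition subst_kernel :: "(nat \<Rightarrow> ('f, nat) trm) \<Rightarrow> ('f, nat) trm set rel" where
  "subst_kernel \<sigma> = {(X, Y). X \<in> univ (free_alg sg E) \<and> Y \<in> univ (free_alg sg E) \<and>
     derivable sg E (subst \<sigma> (rep X)) (subst \<sigma> (rep Y))}"

lemma subst_kernel_eq_class_iff:
  assumes \<sigma>: "\<And>x. wf_trm sg (\<sigma> x)" and s: "wf_trm sg s" and t: "wf_trm sg t"
  shows "(eq_class sg E s, eq_class sg E t) \<in> subst_kernel \<sigma> \<longleftrightarrow>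
    derivable sg E (subst \<sigma> s) (subst \<sigma> t)"
proof -
  have "derivable sg E (subst \<sigma> (rep (eq_class sg E s))) (subst \<sigma> s)"
    "derivable sg E (subst \<sigma> (rep (eq_class sg E t))) (subst \<sigma> t)"
    by (intro derivable_subst rep_eq_class \<sigma> s t)+
  then have "derivable sg E (subst \<sigma> (rep (eq_class sg E s))) (subst \<sigma> (rep (eq_class sg E t)))
      \<longleftrightarrow> derivable sg E (subst \<sigma> s) (subst \<sigma> t)"
    by (meson derivable_sym derivable_trans)
  then show ?thesis
    using eq_class_in_free[OF s] eq_class_in_free[OF t] by (simp add: subst_kernel_def)
qed

lemma congruence_subst_kernel:
  assumes \<sigma>: "\<And>x. wf_trm sg (\<sigma> x)"
  shows "congruence sg (free_alg sg E) (subst_kernel \<sigma>)"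
proof -
  let ?U = "univ (free_alg sg E)"
  have "equiv ?U (subst_kernel \<sigma>)"
    unfolding equiv_def refl_on_def sym_def trans_def subst_kernel_def
    by (auto intro: derivable_refl derivable_sym derivable_trans wf_subst wf_rep \<sigma>)
  moreover have "(oper (free_alg sg E) f Xs, oper (free_alg sg E) f Ys) \<in> subst_kernel \<sigma>"
    if f: "f \<in> symbols sg" and len: "length Xs = arity sg f"
      and XY: "list_all2 (\<lambda>X Y. (X, Y) \<in> subst_kernel \<sigma>) Xs Ys" for f Xs Ys
  proof -
    have "set Xs \<subseteq> ?U" "set Ys \<subseteq> ?U" "length Ys = arity sg f"
      using XY len unfolding subst_kernel_def
      by (auto simp: list_all2_conv_all_nth in_set_conv_nth)
    then have "wf_trm sg (App f (map rep Xs))" "wf_trm sg (App f (map rep Ys))"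
      using f len wf_App_rep by blast+
    moreover have "derivable sg E (subst \<sigma> (App f (map rep Xs))) (subst \<sigma> (App f (map rep Ys)))"
      unfolding subst.simps using XY f len
      by (intro derivable_cong) (auto simp: list_all2_conv_all_nth subst_kernel_def)
    ultimately show ?thesis
      using subst_kernel_eq_class_iff[of \<sigma>, OF \<sigma>] by (simp add: free_alg_def)
  qed
  ultimately show ?thesis
    unfolding congruence_def admissible_def by (auto simp: subst_kernel_def)
qed

end

section \<open>Jonsson terms\<close>

text \<open>A term may contain generators other than the chosen three. They are all treated like the third
  one, both in the substitutions below and in the valuation of the next lemma.\<close>

lemma jonsson_terms_exist:
  fixes sg :: "'f signature" and E :: "'f equation set"
  assumes wfE: "wf_equations sg E" and dist: "three_distributive sg E"
  defines "zx \<equiv> \<lambda>n::nat. if n = 1 then Var 1 else Var 0 :: ('f, nat) trm"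
    and "yx \<equiv> \<lambda>n::nat. if n = 0 \<or> n = 1 then Var 0 else Var 2 :: ('f, nat) trm"
    and "yz \<equiv> \<lambda>n::nat. if n = 0 then Var 0 else Var 2 :: ('f, nat) trm"
  obtains s t where "wf_trm sg s" "wf_trm sg t"
    "derivable sg E (Var 0) (subst zx s)" "derivable sg E (Var 0) (subst yx s)"
    "derivable sg E (subst yz s) (subst yz t)"
    "derivable sg E (subst zx t) (Var 0)" "derivable sg E (subst yx t) (Var 2)"
proof -
  have wf: "\<And>n. wf_trm sg (zx n)" "\<And>n. wf_trm sg (yx n)" "\<And>n. wf_trm sg (yz n)"
    by (simp_all add: zx_def yx_def yz_def)
  let ?F = "free_alg sg E"
  let ?K = "subst_kernel sg E"
  let ?x = "eq_class sg E (Var 0)" and ?y = "eq_class sg E (Var 1)" and ?z = "eq_class sg E (Var 2)"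
  note ker = subst_kernel_eq_class_iff[OF wfE, of zx, OF wf(1)]
    subst_kernel_eq_class_iff[OF wfE, of yx, OF wf(2)]
    subst_kernel_eq_class_iff[OF wfE, of yz, OF wf(3)]
  note cong = congruence_subst_kernel[OF wfE]
  have "(?x, ?z) \<in> ?K zx \<inter> (?K yx O ?K yz)"
  proof
    show "(?x, ?z) \<in> ?K zx" by (simp add: ker) (simp add: zx_def derivable_refl)
    have "(?x, ?y) \<in> ?K yx" by (simp add: ker) (simp add: yx_def derivable_refl)
    moreover have "(?y, ?z) \<in> ?K yz" by (simp add: ker) (simp add: yz_def derivable_refl)
    ultimately show "(?x, ?z) \<in> ?K yx O ?K yz" by blast
  qed
  moreover have "?K zx \<inter> (?K yx O ?K yz) \<subseteq> (?K zx \<inter> ?K yx) O (?K zx \<inter> ?K yz) O (?K zx \<inter> ?K yx)"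
    using dist free_in_variety[OF wfE] cong[of zx, OF wf(1)] cong[of yx, OF wf(2)]
      cong[of yz, OF wf(3)]
    unfolding three_distributive_def by blast
  ultimately have "(?x, ?z) \<in> (?K zx \<inter> ?K yx) O (?K zx \<inter> ?K yz) O (?K zx \<inter> ?K yx)" by blast
  then obtain P Q where PQ: "(?x, P) \<in> ?K zx" "(?x, P) \<in> ?K yx" "(P, Q) \<in> ?K yz"
      "(Q, ?z) \<in> ?K zx" "(Q, ?z) \<in> ?K yx"
    by blast
  then have "P \<in> univ ?F" "Q \<in> univ ?F" unfolding subst_kernel_def[OF wfE] by auto
  then obtain s t where st: "wf_trm sg s" "P = eq_class sg E s" "wf_trm sg t" "Q = eq_class sg E t"
    unfolding free_alg_def by auto
  from PQ have "derivable sg E (Var 0) (subst zx s)" "derivable sg E (Var 0) (subst yx s)"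
    "derivable sg E (subst yz s) (subst yz t)"
    "derivable sg E (subst zx t) (Var 0)" "derivable sg E (subst yx t) (Var 2)"
    by (simp_all add: st ker) (simp_all add: zx_def yx_def)
  with st that show thesis by blast
qed

lemma jonsson_operations_exist:
  fixes A :: "('f, 'a) alg"
  assumes wfE: "wf_equations sg E" and dist: "three_distributive sg E" and A: "in_variety sg E A"
  obtains f g where "jonsson_operations (univ A) f g"
    "\<And>R. refl_on (univ A) R \<Longrightarrow> admissible sg A R \<Longrightarrow>
      jonsson_operations.refl_compatible (univ A) f g R"
proof -
  obtain s t :: "('f, nat) trm" where wf: "wf_trm sg s" "wf_trm sg t"
    and der: "derivable sg E (Var 0) (subst (\<lambda>n. if n = 1 then Var 1 else Var 0) s)"
    "derivable sg E (Var 0) (subst (\<lambda>n. if n = 0 \<or> n = 1 then Var 0 else Var 2) s)"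
    "derivable sg E (subst (\<lambda>n. if n = 0 then Var 0 else Var 2) s)
       (subst (\<lambda>n. if n = 0 then Var 0 else Var 2) t)"
    "derivable sg E (subst (\<lambda>n. if n = 1 then Var 1 else Var 0) t) (Var 0)"
    "derivable sg E (subst (\<lambda>n. if n = 0 \<or> n = 1 then Var 0 else Var 2) t) (Var 2)"
    by (rule jonsson_terms_exist[OF wfE dist]) (rule that)
  define val :: "'a \<Rightarrow> 'a \<Rightarrow> 'a \<Rightarrow> nat \<Rightarrow> 'a" where
    "val = (\<lambda>x y z n. if n = 0 then x else if n = 1 then y else z)"
  define f where "f = (\<lambda>x y z. eval_trm A (val x y z) s)"
  define g where "g = (\<lambda>x y z. eval_trm A (val x y z) t)"
  have alg: "is_algebra sg A" using A unfolding in_variety_def by simp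
  have val: "range (val x y z) \<subseteq> univ A" if "x \<in> univ A" "y \<in> univ A" "z \<in> univ A" for x y z
    using that by (auto simp: val_def)
  have collapse:
    "eval_trm A (val x y z) \<circ> (\<lambda>n. if n = 1 then Var 1 else Var 0) = val x y x"
    "eval_trm A (val x y z) \<circ> (\<lambda>n. if n = 0 \<or> n = 1 then Var 0 else Var 2) = val x x z"
    "eval_trm A (val x y z) \<circ> (\<lambda>n. if n = 0 then Var 0 else Var 2) = val x z z" for x y z
    by (auto simp: val_def fun_eq_iff)
  have eqs: "f x y x = x" "f x x z = x" "f x z z = g x z z" "g x y x = x" "g x x z = z"
    if "x \<in> univ A" "y \<in> univ A" "z \<in> univ A" for x y z
    using der[THEN derivable_sound[OF A val[OF that]]]
    unfolding eval_subst collapse f_def g_def by (auto simp: val_def)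
  have ops: "jonsson_operations (univ A) f g"
  proof
    show "f x y z \<in> univ A" "g x y z \<in> univ A"
      if "x \<in> univ A" "y \<in> univ A" "z \<in> univ A" for x y z
      unfolding f_def g_def using eval_closed[OF alg val[OF that]] wf by auto
  qed (use eqs in auto)
  moreover have "jonsson_operations.refl_compatible (univ A) f g R"
    if "refl_on (univ A) R" and R: "admissible sg A R" for R
    unfolding jonsson_operations.refl_compatible_def[OF ops]
  proof (intro conjI allI impI)
    show "R \<subseteq> univ A \<times> univ A" using R unfolding admissible_def by simp
    fix x y z x' y' z' assume xyz: "(x, x') \<in> R" "(y, y') \<in> R" "(z, z') \<in> R"
    then have "(val x y z n, val x' y' z' n) \<in> R" for n by (simp add: val_def)
    then show "(f x y z, f x' y' z') \<in> R" "(g x y z, g x' y' z') \<in> R"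
      unfolding f_def g_def using eval_admissible[OF R] wf by blast+
  qed (rule that(1))
  ultimately show thesis by (rule that)
qed

theorem theorem3p1:
  fixes sg :: "'f signature" and E :: "'f equation set"
    and A :: "('f, 'a) alg" and R S T \<gamma> :: "'a rel"
  assumes "wf_equations sg E"
    and "three_distributive sg E"
    and "in_variety sg E A"
    and "refl_on (univ A) R" and "admissible sg A R"
    and "refl_on (univ A) S" and "admissible sg A S"
    and "refl_on (univ A) T" and "admissible sg A T"
    and "congruence sg A \<gamma>"
  shows "R \<inter> (S O T) \<subseteq> (R \<inter> S) O (R \<inter> T) O (R \<inter> T) O (R \<inter> S)
    \<and> R \<inter> (S O T) \<subseteq> (R \<inter> S) O (R \<inter> T) O (R \<inter> S) O (R \<inter> T)
    \<and> R \<inter> (S O \<gamma>) \<subseteq> (R \<inter> S) O (R \<inter> \<gamma>) O (R \<inter> S)"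
proof -
  obtain f g where ops: "jonsson_operations (univ A) f g"
    and compat: "\<And>Q. refl_on (univ A) Q \<Longrightarrow> admissible sg A Q \<Longrightarrow>
      jonsson_operations.refl_compatible (univ A) f g Q"
    using jonsson_operations_exist[OF assms(1-3)] by blast
  interpret jonsson_operations "univ A" f g by (rule ops)
  have \<gamma>: "refl_on (univ A) \<gamma>" "admissible sg A \<gamma>" "sym \<gamma>" "trans \<gamma>"
    using assms(10) unfolding congruence_def equiv_def by auto
  note R = compat[OF assms(4,5)] and S = compat[OF assms(6,7)] and T = compat[OF assms(8,9)]
  show ?thesis
    using inclusion_RS_RT_RT_RS[OF R S T] inclusion_RS_RT_RS_RT[OF R S T]
      inclusion_RS_Rcong_RS[OF R S compat[OF \<gamma>(1,2)] \<gamma>(3,4)]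
    by blast
qed

end
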